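(* Let $\lambda\in\mathbb{C}$ with $\lambda\neq 1$, let $r,k\in\mathbb{Z}$ and $n\in\mathbb{Z}_{\geq 0}$. Then \[ T_{n+1}^{(r,k)}(x|\lambda)=(x-r)T_{n}^{(r,k)}(x|\lambda)-\frac{r\lambda}{1-\lambda}T_{n}^{(r+1,k)}(x|\lambda)-\frac{1}{n+1}\sum_{l=0}^{n+1}\binom{n+1}{l}B_{l}\left\{ T_{n+1-l}^{(r,k)}(x|\lambda)-T_{n+1-l}^{(r,k-1)}(x|\lambda)\right\}. \]
   Context: For $k\in\mathbb{Z}$, $Li_k(x)=\sum_{n\ge1}x^n/n^k$. For $r,k\in\mathbb{Z}$ the polynomials $T_n^{(r,k)}(x|\lambda)$ are defined by $\left(\frac{1-\lambda}{e^t-\lambda}\right)^r\frac{Li_{k}(1-e^{-t})}{1-e^{-t}}e^{xt}=\sum_{n\ge0}T_n^{(r,k)}(x|\lambda)\frac{t^n}{n!}$ (as formal power series in $t$). $B_l$ denotes the ordinary Bernoulli numbers, $\frac{t}{e^t-1}=\sum_{l\ge0}B_l\frac{t^l}{l!}$. *)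

theory Defs
  imports Complex_Main "HOL-Computational_Algebra.Computational_Algebra"
begin

definition polylog_fps :: "int \<Rightarrow> complex fps" where
  "polylog_fps k = Abs_fps (\<lambda>n. if n = 0 then 0 else 1 / of_nat n powi k)"

text \<open>The divisor has order 1 and the dividend positive order, so this quotient of power series
  is exact.\<close>

definition polylog_quotient :: "int \<Rightarrow> complex fps" where
  "polylog_quotient k = fps_compose (polylog_fps k) (1 - fps_exp (-1)) / (1 - fps_exp (-1))"

definition kernel_fps :: "int \<Rightarrow> int \<Rightarrow> complex \<Rightarrow> complex fps" where
  "kernel_fps r k lam =
     (fps_const (1 - lam) / (fps_exp 1 - fps_const lam)) powi r * polylog_quotient k"

text \<open>Series in \<open>t\<close> with coefficients in \<open>\<complex>[x]\<close>: \<open>fps_lift_poly\<close> embeds \<open>\<complex>[[t]]\<close>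
  coefficientwise, and \<open>exp_xt\<close> is \<open>e^(xt)\<close> with \<open>x\<close> the polynomial indeterminate
  (\<open>fps_exp\<close> itself needs coefficients in a field).\<close>

definition fps_lift_poly :: "complex fps \<Rightarrow> complex poly fps" where
  "fps_lift_poly f = Abs_fps (\<lambda>n. [:fps_nth f n:])"

definition exp_xt :: "complex poly fps" where
  "exp_xt = Abs_fps (\<lambda>n. monom (1 / fact n) n)"

definition T :: "nat \<Rightarrow> int \<Rightarrow> int \<Rightarrow> complex \<Rightarrow> complex poly" where
  "T n r k lam = smult (fact n) (fps_nth (fps_lift_poly (kernel_fps r k lam) * exp_xt) n)"

definition bernoulli_number :: "nat \<Rightarrow> complex" where
  "bernoulli_number l = fact l * fps_nth (fps_X / (fps_exp 1 - 1)) l"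

text \<open>The three quotients are the intended ones, and evaluating \<open>T\<close> at a number \<open>x\<close> gives the
  coefficients of the generating function with \<open>e^(xt)\<close> the complex exponential series.\<close>

lemma one_minus_fps_exp_nz: "1 - fps_exp (-1) \<noteq> (0 :: complex fps)"
proof
  assume "1 - fps_exp (-1) = (0 :: complex fps)"
  hence "fps_nth (1 - fps_exp (-1) :: complex fps) 1 = 0" by simp
  thus False by simp
qed

lemma polylog_quotient_mult:
  "polylog_quotient k * (1 - fps_exp (-1)) = fps_compose (polylog_fps k) (1 - fps_exp (-1))"
proof -
  have "fps_nth (1 - fps_exp (-1) :: complex fps) 1 \<noteq> 0" by simp
  hence sd: "subdegree (1 - fps_exp (-1) :: complex fps) \<le> 1" by (rule subdegree_leI)
  have 0: "fps_nth (fps_compose (polylog_fps k) (1 - fps_exp (-1))) 0 = 0"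
    by (simp add: polylog_fps_def)
  have "(1 - fps_exp (-1)) dvd fps_compose (polylog_fps k) (1 - fps_exp (-1))"
  proof (cases "fps_compose (polylog_fps k) (1 - fps_exp (-1)) = 0")
    case False
    hence "subdegree (fps_compose (polylog_fps k) (1 - fps_exp (-1))) \<ge> 1"
      using 0 by (intro subdegree_geI) auto
    with sd have "subdegree (1 - fps_exp (-1) :: complex fps) \<le>
                    subdegree (fps_compose (polylog_fps k) (1 - fps_exp (-1)))"
      by (rule order_trans)
    thus ?thesis by (rule fps_dvd_iff [OF one_minus_fps_exp_nz False, THEN iffD2])
  qed (simp only: dvd_0_right)
  thus ?thesis unfolding polylog_quotient_def by (rule dvd_div_mult_self)
qed

lemma kernel_base_mult:
  assumes "lam \<noteq> 1"
  shows "fps_const (1 - lam) / (fps_exp 1 - fps_const lam) * (fps_exp 1 - fps_const lam) =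
           fps_const (1 - lam :: complex)"
proof -
  have "is_unit (fps_exp 1 - fps_const lam :: complex fps)" using assms by simp
  thus ?thesis by (simp only: unit_div_mult_self)
qed

lemma bernoulli_number_egf:
  "Abs_fps (\<lambda>l. bernoulli_number l / fact l) * (fps_exp 1 - 1) = fps_X"
proof -
  have nz: "fps_exp 1 - 1 \<noteq> (0 :: complex fps)"
  proof
    assume "fps_exp 1 - 1 = (0 :: complex fps)"
    hence "fps_nth (fps_exp 1 - 1 :: complex fps) 1 = 0" by simp
    thus False by simp
  qed
  have "fps_nth (fps_exp 1 - 1 :: complex fps) 1 \<noteq> 0" by simp
  hence "subdegree (fps_exp 1 - 1 :: complex fps) \<le> 1" by (rule subdegree_leI)
  hence "(fps_exp 1 - 1 :: complex fps) dvd fps_X" using nz by (simp add: fps_dvd_iff)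
  moreover have "Abs_fps (\<lambda>l. bernoulli_number l / fact l) = fps_X / (fps_exp 1 - 1)"
    by (simp add: bernoulli_number_def fps_eq_iff)
  ultimately show ?thesis by simp
qed

lemma poly_T: "poly (T n r k lam) x = fact n * fps_nth (kernel_fps r k lam * fps_exp x) n"
  by (simp add: T_def fps_lift_poly_def exp_xt_def fps_mult_nth poly_sum poly_monom)

end

theory Submission
  imports Defs
begin

text \<open>Write \<open>F\<^sub>r\<^sub>,\<^sub>k\<close> for the generating function, \<open>G = (1 - \<lambda>) / (e^t - \<lambda>)\<close> and \<open>u = 1 - e^(-t)\<close>.
  The logarithmic derivative of \<open>G\<close> is \<open>-1 - \<lambda> / (1 - \<lambda>) G\<close>, and
  \<open>u Li\<^sub>k'(u) = Li\<^sub>k\<^sub>-\<^sub>1(u)\<close> shows that the derivative of \<open>Li\<^sub>k(u) / u\<close> is the difference of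
  \<open>Li\<^sub>k\<^sub>-\<^sub>1(u) / u\<close> and \<open>Li\<^sub>k(u) / u\<close> divided by \<open>e^t - 1\<close>. Hence, after multiplication of the last
  term by \<open>t\<close>, the derivative of \<open>F\<^sub>r\<^sub>,\<^sub>k\<close> is a combination of \<open>F\<^sub>r\<^sub>,\<^sub>k\<close>, \<open>F\<^sub>r\<^sub>+\<^sub>1\<^sub>,\<^sub>k\<close>
  and \<open>t / (e^t - 1) (F\<^sub>r\<^sub>,\<^sub>k\<^sub>-\<^sub>1 - F\<^sub>r\<^sub>,\<^sub>k)\<close>; compare coefficients.\<close>

text \<open>Power series do not form a field; the nonzero constant coefficient makes
  \<open>f\<close> a unit, which covers negative exponents.\<close>

lemma fps_power_int_add_1:
  fixes f :: "'a::field fps"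
  assumes "fps_nth f 0 \<noteq> 0"
  shows "f powi (r + 1) = f powi r * f"
proof (cases "r \<ge> 0")
  case True
  then show ?thesis by (simp add: power_int_def nat_add_distrib)
next
  case False
  then have "nat (- r) = Suc (nat (- (r + 1)))" by linarith
  with False show ?thesis
    using inverse_mult_eq_1 [OF assms] by (auto simp: power_int_def mult_ac)
qed

text \<open>Here \<open>a\<close> is the logarithmic derivative of \<open>f\<close>, given without a
  division; it gets multiplied by \<open>r\<close>. Induction runs from 0 in both
  directions.\<close>

lemma fps_deriv_power_int:
  fixes f :: "'a::field fps"
  assumes f: "fps_nth f 0 \<noteq> 0" and a: "fps_deriv f = a * f"
  shows "fps_deriv (f powi r) = of_int r * a * f powi r"
proof (induction r rule: int_induct [where k = 0])
  case base
  then show ?case by simp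
next
  case (step1 i)
  then show ?case
    unfolding fps_power_int_add_1 [OF f] by (simp add: a algebra_simps)
next
  case (step2 i)
  define g where "g = f powi (i - 1)"
  have g: "f powi i = g * f"
    using fps_power_int_add_1 [OF f, of "i - 1"] by (simp add: g_def)
  \<comment> \<open>The product rule for \<open>g * f\<close> leaves \<open>i - 1\<close> of the
    \<open>i\<close> copies of \<open>a\<close>; then \<open>f\<close> cancels.\<close>
  have "f * fps_deriv g = f * (of_int (i - 1) * a * g)"
    using step2.IH by (simp add: g a algebra_simps)
  moreover have "f \<noteq> 0" using f by auto
  ultimately show ?case unfolding g_def by (metis mult_left_cancel)
qed

lemma fps_deriv_kernel_base:
  fixes lam :: complex
  assumes "lam \<noteq> 1"
  defines "G \<equiv> fps_const (1 - lam) / (fps_exp 1 - fps_const lam)"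
  shows "fps_deriv G = - (1 + fps_const (lam / (1 - lam)) * G) * G"
proof -
  define d where "d = fps_exp 1 - fps_const lam"
  have Gd: "G * d = fps_const (1 - lam)"
    unfolding G_def d_def by (rule kernel_base_mult [OF assms(1)])
  have "fps_nth d 0 \<noteq> 0" using assms(1) by (simp add: d_def)
  then have "d \<noteq> 0" by auto
  have "fps_deriv (G * d) = 0" by (simp add: Gd)
  then have "fps_deriv G * d = - (G * fps_exp 1)"
    by (simp add: d_def algebra_simps eq_neg_iff_add_eq_0)
  \<comment> \<open>Since \<open>e^t = d + lam\<close>, it suffices to write the constant
    \<open>lam\<close> as \<open>lam / (1 - lam)\<close> times \<open>G * d\<close>.\<close>
  moreover have "(1 + fps_const (lam / (1 - lam)) * G) * G * d = G * fps_exp 1"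
  proof -
    have "(1 + fps_const (lam / (1 - lam)) * G) * G * d
        = G * d + G * fps_const (lam / (1 - lam)) * (G * d)"
      by (simp add: algebra_simps)
    also have "\<dots> = G * d + G * fps_const lam"
      using assms(1) by (simp add: Gd mult.assoc del: fps_const_sub)
    finally show ?thesis by (simp add: d_def algebra_simps)
  qed
  ultimately have "fps_deriv G * d = - (1 + fps_const (lam / (1 - lam)) * G) * G * d"
    by (simp only: mult_minus_left)
  with \<open>d \<noteq> 0\<close> show ?thesis by (metis mult_right_cancel)
qed

text \<open>The operator \<open>X d/dX\<close> multiplies the coefficient \<open>1 / n^k\<close> by
  \<open>n\<close>.\<close>

lemma fps_X_mult_deriv_polylog_fps:
  "fps_X * fps_deriv (polylog_fps k) = polylog_fps (k - 1)"
  by (rule fps_ext) (auto simp: polylog_fps_def power_int_diff fps_X_mult_nth simp del: of_nat_Suc)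

lemma fps_deriv_polylog_quotient:
  "fps_deriv (polylog_quotient k) * (fps_exp 1 - 1) = polylog_quotient (k - 1) - polylog_quotient k"
proof -
  define u :: "complex fps" where "u = 1 - fps_exp (-1)"
  define P where "P = fps_deriv (polylog_fps k) oo u"
  have u0: "fps_nth u 0 = 0" by (simp add: u_def)
  have u: "u \<noteq> 0" unfolding u_def by (rule one_minus_fps_exp_nz)
  have du: "fps_deriv u = fps_exp (-1)" by (simp add: u_def flip: fps_const_neg)
  have Q: "polylog_quotient j * u = polylog_fps j oo u" for j
    unfolding u_def by (rule polylog_quotient_mult)
  have P: "u * P = polylog_quotient (k - 1) * u"
    unfolding Q P_def fps_X_mult_deriv_polylog_fps [symmetric]
    by (simp add: fps_compose_mult_distrib [OF u0] fps_X_fps_compose_startby0 [OF u0])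
  have "fps_deriv (polylog_quotient k * u) = P * fps_exp (-1)"
    unfolding Q P_def by (simp add: fps_compose_deriv [OF u0] du)
  then have "fps_deriv (polylog_quotient k) * u = P * fps_exp (-1) - polylog_quotient k * fps_exp (-1)"
    by (simp add: du algebra_simps eq_diff_eq)
  \<comment> \<open>The extra factor \<open>u\<close> makes \<open>P\<close> occur only in the known
    product \<open>u * P\<close>.\<close>
  then have "u * (fps_deriv (polylog_quotient k) * u)
      = u * P * fps_exp (-1) - u * (polylog_quotient k * fps_exp (-1))"
    by (simp add: right_diff_distrib mult.assoc)
  also have "\<dots> = u * ((polylog_quotient (k - 1) - polylog_quotient k) * fps_exp (-1))"
    unfolding P by (simp add: algebra_simps)
  finally have *: "fps_deriv (polylog_quotient k) * u
      = (polylog_quotient (k - 1) - polylog_quotient k) * fps_exp (-1)"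
    using u by (metis mult_left_cancel)
  have e: "fps_exp (-1) * fps_exp 1 = (1 :: complex fps)"
    by (simp flip: fps_exp_add_mult)
  \<comment> \<open>Multiplication by \<open>e^t\<close> thus turns \<open>u\<close> into
    \<open>e^t - 1\<close> and removes \<open>e^(-t)\<close> on the right.\<close>
  then have ue: "u * fps_exp 1 = fps_exp 1 - 1"
    by (simp add: u_def algebra_simps)
  have "fps_deriv (polylog_quotient k) * u * fps_exp 1
      = (polylog_quotient (k - 1) - polylog_quotient k) * (fps_exp (-1) * fps_exp 1)"
    by (simp only: * mult.assoc)
  then show ?thesis by (simp only: mult.assoc ue e mult_1_right)
qed

text \<open>As \<open>e^t - 1\<close> is not a unit, the factor \<open>X\<close> is split as the
  Bernoulli series times \<open>e^t - 1\<close>.\<close>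

lemma fps_X_mult_deriv_polylog_quotient:
  "fps_X * fps_deriv (polylog_quotient k) =
     Abs_fps (\<lambda>l. bernoulli_number l / fact l) * (polylog_quotient (k - 1) - polylog_quotient k)"
  unfolding bernoulli_number_egf [symmetric] fps_deriv_polylog_quotient [symmetric]
  by (simp add: mult_ac)

text \<open>Product rule for three factors: \<open>e^(xt)\<close> contributes \<open>x\<close>, the
  power of \<open>G\<close> contributes \<open>-r\<close> and the term with \<open>r + 1\<close>,
  and the polylogarithm quotient the Bernoulli term.\<close>

lemma fps_deriv_kernel_fps:
  assumes "lam \<noteq> 1"
  shows "fps_X * fps_deriv (kernel_fps r k lam * fps_exp x) =
     fps_X * (fps_const (x - of_int r) * (kernel_fps r k lam * fps_exp x)
       - fps_const (of_int r * lam / (1 - lam)) * (kernel_fps (r + 1) k lam * fps_exp x))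
     + Abs_fps (\<lambda>l. bernoulli_number l / fact l) *
       (kernel_fps r (k - 1) lam * fps_exp x - kernel_fps r k lam * fps_exp x)"
proof -
  define G where "G = fps_const (1 - lam) / (fps_exp 1 - fps_const lam)"
  define c where "c = fps_const (lam / (1 - lam))"
  define B where "B = Abs_fps (\<lambda>l. bernoulli_number l / fact l)"
  define H where "H = G powi r"
  have "fps_nth (G * (fps_exp 1 - fps_const lam)) 0 = 1 - lam"
    unfolding G_def kernel_base_mult [OF assms] by simp
  then have G0: "fps_nth G 0 \<noteq> 0" using assms by auto
  have dG: "fps_deriv H = of_int r * (- (1 + c * G)) * H"
    unfolding H_def c_def
    by (rule fps_deriv_power_int [OF G0 fps_deriv_kernel_base [OF assms, folded G_def]])
  have K: "kernel_fps r j lam = H * polylog_quotient j" for j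
    by (simp add: kernel_fps_def G_def H_def)
  have K1: "kernel_fps (r + 1) k lam = H * G * polylog_quotient k"
    using fps_power_int_add_1 [OF G0, of r] by (simp add: kernel_fps_def G_def H_def)
  have rx: "fps_const (x - of_int r) = fps_const x - (of_int r :: complex fps)"
    by (simp flip: fps_of_int fps_const_sub)
  have rc: "fps_const (of_int r * lam / (1 - lam)) = of_int r * c"
    by (simp add: c_def flip: fps_of_int)
  have "fps_X * fps_deriv (H * polylog_quotient k * fps_exp x) =
     fps_X * ((fps_const x - of_int r) * (H * polylog_quotient k * fps_exp x)
       - of_int r * c * (H * G * polylog_quotient k * fps_exp x))
     + (fps_X * fps_deriv (polylog_quotient k)) * (H * fps_exp x)"
    by (simp add: dG algebra_simps)
  then show ?thesis
    unfolding K K1 rx rc fps_X_mult_deriv_polylog_quotient B_def [symmetric]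
    by (simp add: algebra_simps)
qed

theorem theorem3:
  fixes lam :: complex and r k :: int and n :: nat
  assumes "lam \<noteq> 1"
  shows "T (n + 1) r k lam =
           [:- of_int r, 1:] * T n r k lam
           - smult (of_int r * lam / (1 - lam)) (T n (r + 1) k lam)
           - smult (1 / of_nat (n + 1))
               (\<Sum>l = 0..n + 1. smult (of_nat ((n + 1) choose l) * bernoulli_number l)
                  (T (n + 1 - l) r k lam - T (n + 1 - l) r (k - 1) lam))"
\<comment> \<open>Evaluation at a number \<open>x\<close> moves the identity to series over
  \<complex>.\<close>
proof (rule poly_ext)
  fix x
  define F where "F = (\<lambda>s j. kernel_fps s j lam * fps_exp x)"
  define B where "B = Abs_fps (\<lambda>l. bernoulli_number l / fact l)"
  have poly_T_F: "poly (T m s j lam) x = fact m * fps_nth (F s j) m" for m s j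
    by (simp add: poly_T F_def)
  \<comment> \<open>The factor \<open>X\<close> shifts the index: coefficient \<open>n + 1\<close>
    here is coefficient \<open>n\<close> of the derivative.\<close>
  have "fps_nth (fps_X * fps_deriv (F r k)) (n + 1)
      = (x - of_int r) * fps_nth (F r k) n
        - of_int r * lam / (1 - lam) * fps_nth (F (r + 1) k) n
        + fps_nth (B * (F r (k - 1) - F r k)) (n + 1)"
    unfolding F_def fps_deriv_kernel_fps [OF assms] B_def by simp
  then have main: "of_nat (n + 1) * fps_nth (F r k) (n + 1)
      = (x - of_int r) * fps_nth (F r k) n
        - of_int r * lam / (1 - lam) * fps_nth (F (r + 1) k) n
        - fps_nth (B * (F r k - F r (k - 1))) (n + 1)"
    by (simp add: algebra_simps)
  \<comment> \<open>The factorials in the binomial coefficient cancel, leaving a Cauchy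
    product.\<close>
  have "(\<Sum>l = 0..n + 1. of_nat ((n + 1) choose l) * bernoulli_number l *
          (fact (n + 1 - l) * fps_nth (F r k) (n + 1 - l)
           - fact (n + 1 - l) * fps_nth (F r (k - 1)) (n + 1 - l)))
      = fact (n + 1) * fps_nth (B * (F r k - F r (k - 1))) (n + 1)"
    unfolding fps_mult_nth sum_distrib_left
    by (rule sum.cong) (auto simp: B_def binomial_fact field_simps simp del: fact_Suc)
  also have "\<dots> = of_nat (n + 1) * (fact n * fps_nth (B * (F r k - F r (k - 1))) (n + 1))"
    by (simp add: algebra_simps)
  finally have conv: "1 / of_nat (n + 1) *
      (\<Sum>l = 0..n + 1. of_nat ((n + 1) choose l) * bernoulli_number l *
          (fact (n + 1 - l) * fps_nth (F r k) (n + 1 - l)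
           - fact (n + 1 - l) * fps_nth (F r (k - 1)) (n + 1 - l)))
      = fact n * fps_nth (B * (F r k - F r (k - 1))) (n + 1)"
    by (simp del: of_nat_Suc of_nat_add)
  have "fact (n + 1) * fps_nth (F r k) (n + 1) = fact n * (of_nat (n + 1) * fps_nth (F r k) (n + 1))"
    by (simp add: algebra_simps)
  then show "poly (T (n + 1) r k lam) x = poly ([:- of_int r, 1:] * T n r k lam
           - smult (of_int r * lam / (1 - lam)) (T n (r + 1) k lam)
           - smult (1 / of_nat (n + 1))
               (\<Sum>l = 0..n + 1. smult (of_nat ((n + 1) choose l) * bernoulli_number l)
                  (T (n + 1 - l) r k lam - T (n + 1 - l) r (k - 1) lam))) x"
    unfolding poly_diff poly_mult poly_smult poly_sum poly_T_F conv main
    by (simp add: algebra_simps)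
qed

end
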